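(* There is an absolute constant $C>0$ such that for all integers $K\ge 2$ and $V\ge 1$ and all sufficiently large $T$ (depending on $K$ and $V$), there is a choice of the threshold $\gamma\in(0,1]$ (depending only on $K,V,T$) for which the following holds. If the volumes $V^t\in\{1,\dots,V\}$ and the maximum consumption levels $s_i^t\in\{0,1,2,\dots\}$ are chosen by an oblivious adversary, then the integer-allocation dark pool algorithm (described in the context) run with threshold $\gamma$ and learning rate $$\eta=\left(\frac{V(\ln K)^2}{K^2T^2}\right)^{1/3}$$ has expected regret over $T$ rounds $$\mathbb{E}[R_T]\le C\,(VTK)^{2/3}(\ln K)^{1/3}.$$
   Context: Dark pool problem with integral allocations. There are $K$ venues. In each round $t=1,\dots,T$ the learner observes a volume $V^t\in\{1,\dots,V\}$ and chooses nonnegative integers $u_i^t$ ($i=1,\dots,K$) with $\sum_{i=1}^K u_i^t\le V^t$. Venue $i$ has an integer maximum consumption level $s_i^t\ge0$, and the learner receives (and observes only) $r_i^t=\min(u_i^t,s_i^t)$. An oblivious adversary chooses all $V^t$ and $s_i^t$ without seeing the algorithm's (random) allocations. Regret. Let $\Delta_K^V$ be the set of $w=(w^1,\dots,w^V)$ with each $w^v=(w_1^v,\dots,w_K^v)$ a probability vector in $\mathbb{R}^K$. The regret is $$R_T=\max_{w\in\Delta_K^V}\sum_{t=1}^T\sum_{i=1}^K\left[\min\left(\sum_{v=1}^{V^t}w_i^v,\,s_i^t\right)-\min(u_i^t,s_i^t)\right],$$ and the expectation is over the algorithm's randomness. Integer-allocation dark pool algorithm. Input: learning rate $\eta>0$,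 threshold $\gamma\in(0,1]$, bound $V$ on volumes. Initialize $x_{1,i}^v=1/K$ for $1\le v\le V$, $1\le i\le K$. For $t=1,\dots,T$: 1. Set $v_i^t=\sum_{v=1}^{V^t}x_{t,i}^v$, $f_i^t=\lfloor v_i^t\rfloor$, $d_i^t=v_i^t-f_i^t$, $m=\sum_{i=1}^K d_i^t=V^t-\sum_{i=1}^K f_i^t$ (an integer), and $\bar d_{t,i}=(1-\gamma)d_i^t+\gamma m/K$. 2. Sample (with fresh randomness) a subset of $\{1,\dots,K\}$ of size $m$ from a distribution under which each $i$ belongs to the subset with probability $\bar d_{t,i}$. (Such a distribution is obtained by mixing, with weights $1-\gamma$ and $\gamma$, a distribution on $m$-subsets with inclusion probabilities $d_i^t$ and the uniform distribution on $m$-subsets.) 3. Play $u_i^t=f_i^t+1$ if $i$ is in the sampled subset and $u_i^t=f_i^t$ otherwise; receive $r_i^t=\min(u_i^t,s_i^t)$. 4. Let $\tilde V_{t,i}\le V^t$ be the largest index $v_0$ such that $\sum_{v=1}^{v_0}x_{t,i}^v\le f_i^t$. Let $\chi_i^t=1$ if $i$ is in the sampled subset (i.e. the allocation at venue $i$ was rounded up) and $\chi_i^t=0$ otherwise. Define $$\tilde g_{t,i}^v=\begin{cases}\mathbf 1(s_i^t\ge f_i^t)-\dfrac{\mathbf 1(s_i^t=f_i^t)\,\chi_i^t}{\bar d_{t,i}} & \text{if } v\le\tilde V_{t,i},\\[2mm] \dfrac{\mathbf 1(s_i^t\ge v_i^t)\,\chi_i^t}{\bar d_{t,i}} & \text{if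 }\tilde V_{t,i}+1\le v\le V^t,\\[2mm] 0&\text{if } v>V^t,\end{cases}$$ with the convention that terms containing $\chi_i^t/\bar d_{t,i}$ are $0$ when $m=0$ (in which case $\bar d_{t,i}=0$ and $\chi_i^t=0$). 5. Update $x_{t+1,i}^v\propto x_{t,i}^v\exp(\eta\tilde g_{t,i}^v)$, normalized so that $\sum_{i=1}^K x_{t+1,i}^v=1$ for each $v$. *)

theory Defs
  imports "HOL-Probability.Probability"
begin

text \<open>
  Venues are \<open>{1..K}\<close>, unit indices are \<open>{1..V}\<close>, rounds are \<open>{..<T}\<close> (so the first round has
  number 0). Within a single round, \<open>n\<close> is the volume to be allocated, \<open>s i\<close> the maximum
  consumption level of venue \<open>i\<close>, and \<open>x v i\<close> the weight of venue \<open>i\<close> for unit \<open>v\<close>.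
  Only indices in the above ranges matter.
\<close>

type_synonym weights = "nat \<Rightarrow> nat \<Rightarrow> real"

definition alloc :: "weights \<Rightarrow> nat \<Rightarrow> nat \<Rightarrow> real" where
  "alloc x n i = (\<Sum>v=1..n. x v i)"

definition alloc_floor :: "weights \<Rightarrow> nat \<Rightarrow> nat \<Rightarrow> nat" where
  "alloc_floor x n i = nat \<lfloor>alloc x n i\<rfloor>"

text \<open>
  As \<open>x v\<close> is a probability vector on \<open>{1..K}\<close> for every \<open>v\<close>, the subtraction below does not
  truncate, and the result is the sum of the fractional parts of the allocations.
\<close>

definition num_up :: "nat \<Rightarrow> weights \<Rightarrow> nat \<Rightarrow> nat" where
  "num_up K x n = n - (\<Sum>i=1..K. alloc_floor x n i)"

definition incl_prob :: "nat \<Rightarrow> real \<Rightarrow> weights \<Rightarrow> nat \<Rightarrow> nat \<Rightarrow> real" where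
  "incl_prob K \<gamma> x n i = (1 - \<gamma>) * frac (alloc x n i) + \<gamma> * real (num_up K x n) / real K"

text \<open>The index 0 (empty sum) is admissible here, so the set is never empty.\<close>

definition last_floor_index :: "weights \<Rightarrow> nat \<Rightarrow> nat \<Rightarrow> nat" where
  "last_floor_index x n i = Max {v0. v0 \<le> n \<and> (\<Sum>v=1..v0. x v i) \<le> real (alloc_floor x n i)}"

text \<open>
  \<open>A\<close> is the sampled set of venues that are rounded up. If \<open>num_up K x n = 0\<close> then \<open>A\<close> is empty
  and all quotients below are \<open>0 / 0 = 0\<close>.
\<close>

definition grad_est ::
  "nat \<Rightarrow> real \<Rightarrow> weights \<Rightarrow> nat \<Rightarrow> (nat \<Rightarrow> nat) \<Rightarrow> nat set \<Rightarrow> nat \<Rightarrow> nat \<Rightarrow> real" where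
  "grad_est K \<gamma> x n s A v i =
     (if v \<le> last_floor_index x n i then
        of_bool (s i \<ge> alloc_floor x n i)
          - of_bool (s i = alloc_floor x n i) * of_bool (i \<in> A) / incl_prob K \<gamma> x n i
      else if v \<le> n then
        of_bool (real (s i) \<ge> alloc x n i) * of_bool (i \<in> A) / incl_prob K \<gamma> x n i
      else 0)"

definition update_weights ::
  "nat \<Rightarrow> real \<Rightarrow> real \<Rightarrow> nat \<Rightarrow> (nat \<Rightarrow> nat) \<Rightarrow> nat set \<Rightarrow> weights \<Rightarrow> weights" where
  "update_weights K \<eta> \<gamma> n s A x = (\<lambda>v i.
     x v i * exp (\<eta> * grad_est K \<gamma> x n s A v i)
       / (\<Sum>j=1..K. x v j * exp (\<eta> * grad_est K \<gamma> x n s A v j)))"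

text \<open>
  \<open>vol t\<close> and \<open>lev t i\<close> are the adversary's volumes and consumption levels. Being oblivious,
  they are fixed sequences. \<open>\<omega> t\<close> is the set sampled in round \<open>t\<close>.
\<close>

primrec weights_at ::
  "nat \<Rightarrow> real \<Rightarrow> real \<Rightarrow> (nat \<Rightarrow> nat) \<Rightarrow> (nat \<Rightarrow> nat \<Rightarrow> nat) \<Rightarrow> (nat \<Rightarrow> nat set) \<Rightarrow> nat \<Rightarrow> weights"
where
  "weights_at K \<eta> \<gamma> vol lev \<omega> 0 = (\<lambda>v i. 1 / real K)"
| "weights_at K \<eta> \<gamma> vol lev \<omega> (Suc t) =
     update_weights K \<eta> \<gamma> (vol t) (lev t) (\<omega> t) (weights_at K \<eta> \<gamma> vol lev \<omega> t)"

definition play ::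
  "nat \<Rightarrow> real \<Rightarrow> real \<Rightarrow> (nat \<Rightarrow> nat) \<Rightarrow> (nat \<Rightarrow> nat \<Rightarrow> nat) \<Rightarrow> (nat \<Rightarrow> nat set) \<Rightarrow> nat \<Rightarrow> nat \<Rightarrow> nat"
where
  "play K \<eta> \<gamma> vol lev \<omega> t i =
     alloc_floor (weights_at K \<eta> \<gamma> vol lev \<omega> t) (vol t) i + of_bool (i \<in> \<omega> t)"

text \<open>
  The distribution from which a round's subset is drawn is left open by the algorithm, apart from
  its support and its inclusion probabilities. A sampler \<open>S\<close> yields the distribution
  used in round \<open>t\<close> given the sets drawn so far. \<open>run S T\<close> is the law of the sets
  drawn in the first \<open>T\<close> rounds; entries for later rounds are \<open>{}\<close>.
\<close>

type_synonym sampler = "nat \<Rightarrow> (nat \<Rightarrow> nat set) \<Rightarrow> nat set pmf"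

primrec run :: "sampler \<Rightarrow> nat \<Rightarrow> (nat \<Rightarrow> nat set) pmf" where
  "run S 0 = return_pmf (\<lambda>_. {})"
| "run S (Suc t) = bind_pmf (run S t) (\<lambda>\<omega>. map_pmf (\<lambda>A. fun_upd \<omega> t A) (S t \<omega>))"

definition valid_sampler ::
  "nat \<Rightarrow> real \<Rightarrow> real \<Rightarrow> (nat \<Rightarrow> nat) \<Rightarrow> (nat \<Rightarrow> nat \<Rightarrow> nat) \<Rightarrow> nat \<Rightarrow> sampler \<Rightarrow> bool" where
  "valid_sampler K \<eta> \<gamma> vol lev T S \<longleftrightarrow>
     (\<forall>t<T. \<forall>\<omega>\<in>set_pmf (run S t).
        let x = weights_at K \<eta> \<gamma> vol lev \<omega> t in
        (\<forall>A\<in>set_pmf (S t \<omega>). A \<subseteq> {1..K} \<and> card A = num_up K x (vol t)) \<and>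
        (\<forall>i\<in>{1..K}. measure_pmf.prob (S t \<omega>) {A. i \<in> A} = incl_prob K \<gamma> x (vol t) i))"

definition comparators :: "nat \<Rightarrow> nat \<Rightarrow> weights set" where
  "comparators K V =
     {w. \<forall>v\<in>{1..V}. (\<forall>i\<in>{1..K}. 0 \<le> w v i) \<and> (\<Sum>i=1..K. w v i) = 1}"

text \<open>
  The supremum is a maximum: the objective is a continuous function of finitely many coordinates,
  which range over a nonempty compact set.
\<close>

definition regret ::
  "nat \<Rightarrow> nat \<Rightarrow> nat \<Rightarrow> (nat \<Rightarrow> nat) \<Rightarrow> (nat \<Rightarrow> nat \<Rightarrow> nat) \<Rightarrow> (nat \<Rightarrow> nat \<Rightarrow> nat) \<Rightarrow> real" where
  "regret K V T vol lev u =
     (SUP w\<in>comparators K V. \<Sum>t<T. \<Sum>i=1..K.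
        (min (\<Sum>v=1..vol t. w v i) (real (lev t i)) - real (min (u t i) (lev t i))))"

definition expected_regret ::
  "nat \<Rightarrow> nat \<Rightarrow> nat \<Rightarrow> real \<Rightarrow> real \<Rightarrow> (nat \<Rightarrow> nat) \<Rightarrow> (nat \<Rightarrow> nat \<Rightarrow> nat) \<Rightarrow> sampler \<Rightarrow> real" where
  "expected_regret K V T \<eta> \<gamma> vol lev S =
     measure_pmf.expectation (run S T) (\<lambda>\<omega>. regret K V T vol lev (play K \<eta> \<gamma> vol lev \<omega>))"

definition learning_rate :: "nat \<Rightarrow> nat \<Rightarrow> nat \<Rightarrow> real" where
  "learning_rate K V T = (real V * (ln (real K))\<^sup>2 / ((real K)\<^sup>2 * (real T)\<^sup>2)) powr (1 / 3)"

end

theory Submission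
  imports Defs
begin

text \<open>
  For each unit \<open>v\<close> the weights follow exponential weights, so \<open>\<Sum>v i. w v i * ln (x v i)\<close> serves as a
  potential for the comparator \<open>w\<close>. Conditionally on the past, the gradient estimate averages to a
  supergradient of \<open>min _ (s i)\<close> at the fractional allocation, and since every inclusion probability
  is at least \<open>\<gamma> / K\<close> (unless no venue is rounded up), its second moment is at most \<open>K / \<gamma>\<close>. As the
  levels are integers, unbiased rounding loses nothing in expectation, and mixing with the uniform
  distribution costs at most \<open>\<gamma> * K\<close> per round. The regret is therefore at most
  \<open>V ln K / \<eta> + T (\<eta> V K / \<gamma> + \<gamma> K)\<close>. The comparator's reward does not depend on the sampled sets,
  so the supremum may be taken outside the expectation.
\<close>

declare One_nat_def [simp del]

section \<open>Exponential weights: a single update\<close>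

text \<open>For negative \<open>y\<close>, multiplying the right-hand side by \<open>1 - y\<close>
  gives \<open>1 - y ^ 3\<close>, which is at least 1, while \<open>1 - y \<le> exp (- y)\<close>.
  Since \<open>y\<close> is only bounded above, the gradient estimates have to be controlled from
  above only.\<close>

lemma exp_le_quadratic:
  fixes y :: real
  assumes "y \<le> 1"
  shows "exp y \<le> 1 + y + y\<^sup>2"
proof (cases "0 \<le> y")
  case True
  then show ?thesis using assms by (rule exp_bound)
next
  case False
  have "1 \<le> (1 + y + y\<^sup>2) * (1 - y)"
    using False zero_le_power[of "- y" 3] by (simp add: algebra_simps power2_eq_square power3_eq_cube)
  also have "\<dots> \<le> (1 + y + y\<^sup>2) * exp (- y)"
  proof (rule mult_left_mono)
    show "1 - y \<le> exp (- y)" using exp_ge_add_one_self[of "- y"] by simp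
    show "0 \<le> 1 + y + y\<^sup>2" using zero_le_power2[of "y + 1 / 2"]
      by (simp add: power2_eq_square algebra_simps)
  qed
  finally show ?thesis by (simp add: exp_minus field_simps)
qed

text \<open>The quadratic bound on \<open>exp\<close> and \<open>ln Z \<le> Z - 1\<close> control
  the logarithm of the normaliser \<open>Z\<close>. Since \<open>w\<close> has total mass 1,
  \<open>ln Z\<close> is subtracted exactly once.\<close>

lemma exponential_weights_step:
  fixes x w g :: "'a \<Rightarrow> real"
  assumes I: "finite I"
    and x: "\<And>i. i \<in> I \<Longrightarrow> 0 < x i" "(\<Sum>i\<in>I. x i) = 1"
    and w: "(\<Sum>i\<in>I. w i) = 1"
    and g: "\<And>i. i \<in> I \<Longrightarrow> \<eta> * g i \<le> 1"
  shows "(\<Sum>i\<in>I. w i * ln (x i)) + \<eta> * (\<Sum>i\<in>I. (w i - x i) * g i) - \<eta>\<^sup>2 * (\<Sum>i\<in>I. x i * (g i)\<^sup>2)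
    \<le> (\<Sum>i\<in>I. w i * ln (x i * exp (\<eta> * g i) / (\<Sum>j\<in>I. x j * exp (\<eta> * g j))))"
proof -
  define Z where "Z = (\<Sum>j\<in>I. x j * exp (\<eta> * g j))"
  have "I \<noteq> {}" using w by auto
  then have Zpos: "Z > 0" unfolding Z_def using I x by (intro sum_pos) auto
  have "Z \<le> (\<Sum>j\<in>I. x j * (1 + \<eta> * g j + (\<eta> * g j)\<^sup>2))"
    unfolding Z_def using x g by (intro sum_mono mult_left_mono exp_le_quadratic) (auto simp: less_imp_le)
  also have "\<dots> = 1 + (\<eta> * (\<Sum>j\<in>I. x j * g j) + \<eta>\<^sup>2 * (\<Sum>j\<in>I. x j * (g j)\<^sup>2))"
    by (simp add: distrib_left sum.distrib x sum_distrib_left power_mult_distrib mult_ac)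
  finally have "ln Z \<le> \<eta> * (\<Sum>j\<in>I. x j * g j) + \<eta>\<^sup>2 * (\<Sum>j\<in>I. x j * (g j)\<^sup>2)"
    using ln_le_minus_one[OF Zpos] by linarith
  moreover have "(\<Sum>i\<in>I. w i * ln (x i * exp (\<eta> * g i) / Z))
      = (\<Sum>i\<in>I. w i * ln (x i) + \<eta> * (w i * g i) - w i * ln Z)"
  proof (rule sum.cong[OF refl])
    fix i assume "i \<in> I"
    then have "ln (x i * exp (\<eta> * g i) / Z) = ln (x i) + \<eta> * g i - ln Z"
      using x(1)[of i] Zpos by (simp add: ln_div ln_mult)
    then show "w i * ln (x i * exp (\<eta> * g i) / Z) = w i * ln (x i) + \<eta> * (w i * g i) - w i * ln Z"
      by (simp only:) (simp add: algebra_simps)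
  qed
  moreover have "\<dots> = (\<Sum>i\<in>I. w i * ln (x i)) + \<eta> * (\<Sum>i\<in>I. w i * g i) - ln Z"
    by (simp add: sum.distrib sum_subtractf w flip: sum_distrib_left sum_distrib_right)
  ultimately show ?thesis
    unfolding Z_def[symmetric] by (simp add: left_diff_distrib sum_subtractf algebra_simps)
qed

section \<open>One round with fixed weights\<close>

text \<open>The extra unit is consumed exactly when the floor is strictly below the level, so the
  reward is affine in the rounding indicator.\<close>

lemma min_add_of_bool:
  "real (min (f + of_bool b) s) = real (min f s) + of_bool (f < s) * of_bool b"
  by auto

locale allocation_round =
  fixes K n :: nat and \<gamma> :: real and x :: weights and s :: "nat \<Rightarrow> nat"
  assumes K: "0 < K" and \<gamma>: "0 < \<gamma>" "\<gamma> \<le> 1"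
    and x_pos: "\<And>v i. i \<in> {1..K} \<Longrightarrow> 0 < x v i"
    and x_sum: "\<And>v. (\<Sum>i=1..K. x v i) = 1"
begin

abbreviation "a \<equiv> alloc x n"
abbreviation "f \<equiv> alloc_floor x n"
abbreviation "m \<equiv> num_up K x n"
abbreviation "q \<equiv> incl_prob K \<gamma> x n"

text \<open>When no venue is rounded up, the estimate is deterministic and equals the left derivative.\<close>

definition supergrad :: "nat \<Rightarrow> real" where
  "supergrad i = of_bool (if m = 0 then f i \<le> s i else f i < s i)"

lemma alloc_nonneg: "i \<in> {1..K} \<Longrightarrow> 0 \<le> a i"
  unfolding alloc_def using x_pos by (intro sum_nonneg) (auto simp: less_imp_le)

lemma frac_alloc: "i \<in> {1..K} \<Longrightarrow> frac (a i) = a i - real (f i)"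
  using alloc_nonneg[of i] by (simp add: frac_def alloc_floor_def)

lemma floor_le_alloc: "i \<in> {1..K} \<Longrightarrow> real (f i) \<le> a i"
  and alloc_less_floor: "i \<in> {1..K} \<Longrightarrow> a i < real (f i) + 1"
  using frac_alloc[of i] frac_ge_0[of "a i"] frac_lt_1[of "a i"] by linarith+

lemma sum_alloc: "(\<Sum>i=1..K. a i) = real n"
  unfolding alloc_def by (subst sum.swap) (simp add: x_sum del: One_nat_def)

text \<open>The floors sum to at most \<open>n\<close>, so the truncating subtraction in
  \<open>num_up\<close> is exact.\<close>

lemma num_up_eq: "real m = (\<Sum>i=1..K. frac (a i))"
proof -
  have "real (\<Sum>i=1..K. f i) \<le> (\<Sum>i=1..K. a i)"
    unfolding of_nat_sum using floor_le_alloc by (rule sum_mono)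
  then have "(\<Sum>i=1..K. f i) \<le> n" unfolding sum_alloc of_nat_le_iff .
  then have "real m = real n - (\<Sum>i=1..K. real (f i))" by (simp add: num_up_def of_nat_diff)
  also have "\<dots> = (\<Sum>i=1..K. frac (a i))"
    by (simp add: frac_alloc sum_subtractf sum_alloc)
  finally show ?thesis .
qed

lemma frac_alloc_eq_0: "m = 0 \<Longrightarrow> i \<in> {1..K} \<Longrightarrow> frac (a i) = 0"
  using num_up_eq by (simp add: sum_nonneg_eq_0_iff)

lemma incl_prob_eq_0: "m = 0 \<Longrightarrow> i \<in> {1..K} \<Longrightarrow> q i = 0"
  by (simp add: incl_prob_def frac_alloc_eq_0)

lemma incl_prob_ge_frac: "(1 - \<gamma>) * frac (a i) \<le> q i"
  using \<gamma> K by (simp add: incl_prob_def)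

lemma incl_prob_ge: "m \<noteq> 0 \<Longrightarrow> \<gamma> / K \<le> q i"
proof -
  assume "m \<noteq> 0"
  then have "\<gamma> * 1 / K \<le> \<gamma> * real m / K"
    using \<gamma> K by (intro divide_right_mono mult_left_mono) auto
  moreover have "0 \<le> (1 - \<gamma>) * frac (a i)" using \<gamma> by simp
  ultimately show ?thesis by (simp add: incl_prob_def)
qed

lemma incl_prob_pos: "m \<noteq> 0 \<Longrightarrow> 0 < q i"
  using incl_prob_ge[of i] \<gamma> K by (meson divide_pos_pos less_le_trans of_nat_0_less_iff)

lemma inverse_incl_prob_le: "m \<noteq> 0 \<Longrightarrow> 1 / q i \<le> K / \<gamma>"
  using incl_prob_ge[of i] incl_prob_pos[of i] \<gamma> K by (simp add: field_simps)

lemma one_le_K_div: "1 \<le> K / \<gamma>"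
  using \<gamma> K by (simp add: field_simps)

lemma last_floor_index_le: "last_floor_index x n i \<le> n"
  unfolding last_floor_index_def by (rule Max.boundedI) (auto intro!: exI[of _ "0::nat"])

text \<open>For an integral allocation, \<open>v0 = n\<close> meets the constraint with equality.
  All units up to \<open>n\<close> then fall into the first branch of
  \<open>grad_est\<close>.\<close>

lemma last_floor_index_eq: "i \<in> {1..K} \<Longrightarrow> frac (a i) = 0 \<Longrightarrow> last_floor_index x n i = n"
  unfolding last_floor_index_def by (rule Max_eqI) (simp_all add: frac_alloc flip: alloc_def)

text \<open>The kink of \<open>min _ (s i)\<close> is at an integer, so on the unit interval
  starting at \<open>f i\<close> the function is linear, with slope 1 if \<open>f i < s i\<close>
  and 0 otherwise. If \<open>m = 0\<close>, the allocation is integral and may sit on the kink,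
  where the left slope is a supergradient too.\<close>

lemma supergrad:
  assumes i: "i \<in> {1..K}"
  shows "min W (real (s i)) \<le> min (a i) (real (s i)) + supergrad i * (W - a i)"
  using frac_alloc[OF i] frac_alloc_eq_0[OF _ i] floor_le_alloc[OF i] alloc_less_floor[OF i]
  by (auto simp: supergrad_def)

text \<open>
  If a unit beyond the last floor index exists, the allocation is not integral, so that reaching it
  and exceeding its floor are the same for the integer consumption level.
\<close>

lemma grad_est_cases:
  assumes i: "i \<in> {1..K}" and v: "v \<le> n"
  obtains "m = 0" "\<And>A. grad_est K \<gamma> x n s A v i = supergrad i"
  | "m \<noteq> 0" "\<And>A. grad_est K \<gamma> x n s A v i = of_bool (f i \<le> s i) - of_bool (s i = f i) * of_bool (i \<in> A) / q i"
  | "m \<noteq> 0" "\<And>A. grad_est K \<gamma> x n s A v i = supergrad i * of_bool (i \<in> A) / q i"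
proof (cases "m = 0")
  case True
  then show ?thesis
    using that(1) v last_floor_index_eq[OF i] frac_alloc_eq_0[OF _ i] incl_prob_eq_0[OF _ i]
    by (simp add: grad_est_def supergrad_def)
next
  case m: False
  show ?thesis
  proof (cases "v \<le> last_floor_index x n i")
    case True
    then show ?thesis using that(2) m by (simp add: grad_est_def)
  next
    case False
    then have "frac (a i) \<noteq> 0" using v last_floor_index_eq[OF i] by auto
    then have "real (f i) < a i" using frac_alloc[OF i] floor_le_alloc[OF i] by linarith
    then have "a i \<le> real (s i) \<longleftrightarrow> f i < s i" using alloc_less_floor[OF i] by linarith
    then show ?thesis using that(3) m False v by (simp add: grad_est_def supergrad_def)
  qed
qed

lemma grad_est_beyond: "n < v \<Longrightarrow> grad_est K \<gamma> x n s A v i = 0"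
  using last_floor_index_le[of i] by (simp add: grad_est_def)

text \<open>Through this bound, \<open>\<eta> * (K / \<gamma>) \<le> 1\<close> yields the exponent
  condition of \<open>exponential_weights_step\<close>.\<close>

lemma grad_est_le:
  assumes i: "i \<in> {1..K}"
  shows "grad_est K \<gamma> x n s A v i \<le> K / \<gamma>"
proof (cases "v \<le> n")
  case True
  from i this show ?thesis
  proof (cases rule: grad_est_cases)
    case 1
    then show ?thesis using one_le_K_div by (simp add: supergrad_def)
  next
    case 2
    have "grad_est K \<gamma> x n s A v i \<le> 1"
      using incl_prob_pos[OF 2(1), of i] by (auto simp: 2)
    then show ?thesis using one_le_K_div by linarith
  next
    case 3
    then show ?thesis using inverse_incl_prob_le[of i] \<gamma> by (simp add: supergrad_def)
  qed
next
  case False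
  then show ?thesis using \<gamma> by (simp add: grad_est_beyond)
qed

end

section \<open>Expectations over the sampled set\<close>

locale sampled_round = allocation_round +
  fixes p :: "nat set pmf"
  assumes supp: "\<And>A. A \<in> set_pmf p \<Longrightarrow> A \<subseteq> {1..K}"
    and incl: "\<And>i. i \<in> {1..K} \<Longrightarrow> measure_pmf.prob p {A. i \<in> A} = incl_prob K \<gamma> x n i"
begin

lemma integrable [simp]: "integrable (measure_pmf p) (h :: nat set \<Rightarrow> real)"
proof (rule integrable_measure_pmf_finite)
  have "set_pmf p \<subseteq> Pow {1..K}" using supp by auto
  then show "finite (set_pmf p)" by (rule finite_subset) simp
qed

lemma incl_prob_le_1: "i \<in> {1..K} \<Longrightarrow> q i \<le> 1"
  using incl[of i] measure_pmf.prob_le_1 by metis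

lemma expectation_mem:
  assumes "i \<in> {1..K}"
  shows "measure_pmf.expectation p (\<lambda>A. of_bool (i \<in> A)) = q i"
proof -
  have "measure_pmf.expectation p (\<lambda>A. of_bool (i \<in> A)) = measure_pmf.expectation p (indicator {A. i \<in> A} :: _ \<Rightarrow> real)"
    by (rule Bochner_Integration.integral_cong) (auto simp: indicator_def)
  then show ?thesis using incl[OF assms] by simp
qed

text \<open>The estimate, its square and the reward at a venue are all affine in that venue's
  membership indicator, so inclusion probabilities determine their expectations.\<close>

lemma expectation_affine:
  assumes i: "i \<in> {1..K}" and h: "\<And>A. h A = c + d * of_bool (i \<in> A)"
  shows "measure_pmf.expectation p h = c + d * q i"
proof -
  have "measure_pmf.expectation p h = measure_pmf.expectation p (\<lambda>A. c + d * of_bool (i \<in> A))"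
    by (rule Bochner_Integration.integral_cong) (simp_all add: h)
  then show ?thesis by (simp add: expectation_mem[OF i])
qed

text \<open>Both branches are unbiased for the same slope: importance weighting cancels
  \<open>q i\<close>, and in the first branch subtracting the indicator of \<open>s i = f i\<close>
  from that of \<open>f i \<le> s i\<close> leaves that of \<open>f i < s i\<close>.\<close>

lemma expectation_grad_est:
  assumes i: "i \<in> {1..K}"
  shows "measure_pmf.expectation p (\<lambda>A. grad_est K \<gamma> x n s A v i) = of_bool (v \<le> n) * supergrad i"
proof (cases "v \<le> n")
  case True
  from i this show ?thesis
  proof (cases rule: grad_est_cases)
    case 1
    then show ?thesis using True by simp
  next
    case 2
    have "measure_pmf.expectation p (\<lambda>A. grad_est K \<gamma> x n s A v i)
      = of_bool (f i \<le> s i) + (- of_bool (s i = f i) / q i) * q i"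
      by (rule expectation_affine[OF i]) (simp add: 2)
    then show ?thesis using True 2 incl_prob_pos[of i] by (auto simp: supergrad_def)
  next
    case 3
    have "measure_pmf.expectation p (\<lambda>A. grad_est K \<gamma> x n s A v i) = 0 + (supergrad i / q i) * q i"
      by (rule expectation_affine[OF i]) (simp add: 3)
    then show ?thesis using True 3 incl_prob_pos[of i] by simp
  qed
next
  case False
  then show ?thesis by (simp add: grad_est_beyond)
qed

lemma expectation_grad_est_sq_le:
  assumes i: "i \<in> {1..K}"
  shows "measure_pmf.expectation p (\<lambda>A. (grad_est K \<gamma> x n s A v i)\<^sup>2) \<le> K / \<gamma>"
proof (cases "v \<le> n")
  case True
  from i this show ?thesis
  proof (cases rule: grad_est_cases)
    case 1
    then show ?thesis using one_le_K_div by (simp add: supergrad_def)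
  next
    case 2
    \<comment> \<open>The membership indicator equals its own square. The value is
      \<open>1 / q i - 1\<close> if \<open>s i = f i\<close>, and otherwise at most 1, hence at most
      \<open>1 / q i\<close> as \<open>q i \<le> 1\<close>.\<close>
    have "measure_pmf.expectation p (\<lambda>A. (grad_est K \<gamma> x n s A v i)\<^sup>2)
      = of_bool (f i \<le> s i) + (of_bool (s i = f i) * (1 / (q i)\<^sup>2 - 2 / q i)) * q i"
      by (rule expectation_affine[OF i]) (auto simp: 2 power2_eq_square algebra_simps)
    also have "\<dots> \<le> 1 / q i"
      using incl_prob_pos[OF 2(1), of i] incl_prob_le_1[OF i] by (auto simp: field_simps power2_eq_square)
    finally show ?thesis using inverse_incl_prob_le[OF 2(1), of i] by simp
  next
    case 3
    have "measure_pmf.expectation p (\<lambda>A. (grad_est K \<gamma> x n s A v i)\<^sup>2)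
      = 0 + (supergrad i / (q i)\<^sup>2) * q i"
      by (rule expectation_affine[OF i]) (auto simp: 3 supergrad_def power2_eq_square)
    also have "\<dots> \<le> 1 / q i"
      using incl_prob_pos[OF 3(1), of i] by (auto simp: supergrad_def field_simps power2_eq_square)
    finally show ?thesis using inverse_incl_prob_le[OF 3(1), of i] by simp
  qed
next
  case False
  then show ?thesis using \<gamma> by (simp add: grad_est_beyond)
qed

text \<open>Rounding up with probability exactly \<open>frac (a i)\<close> would give expected
  reward \<open>min (a i) (s i)\<close>, because the level is an integer. Mixing lowers the
  inclusion probability by at most \<open>\<gamma>\<close> at each venue.\<close>

lemma expectation_reward_ge:
  "(\<Sum>i=1..K. min (a i) (real (s i))) - \<gamma> * K
    \<le> measure_pmf.expectation p (\<lambda>A. \<Sum>i=1..K. real (min (f i + of_bool (i \<in> A)) (s i)))"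
proof -
  have "(\<Sum>i=1..K. min (a i) (real (s i))) - \<gamma> * K = (\<Sum>i=1..K. min (a i) (real (s i)) - \<gamma>)"
    by (simp add: sum_subtractf)
  also have "\<dots> \<le> (\<Sum>i=1..K. measure_pmf.expectation p (\<lambda>A. real (min (f i + of_bool (i \<in> A)) (s i))))"
  proof (rule sum_mono)
    fix i assume i: "i \<in> {1..K}"
    have "measure_pmf.expectation p (\<lambda>A. real (min (f i + of_bool (i \<in> A)) (s i)))
      = real (min (f i) (s i)) + of_bool (f i < s i) * q i"
      by (rule expectation_affine[OF i min_add_of_bool])
    moreover have "\<gamma> * frac (a i) \<le> \<gamma>"
      using \<gamma> frac_lt_1[of "a i"] by (simp add: mult_left_le)
    then have "frac (a i) - \<gamma> \<le> q i"
      using incl_prob_ge_frac[of i] by (simp add: algebra_simps)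
    ultimately show "min (a i) (real (s i)) - \<gamma>
      \<le> measure_pmf.expectation p (\<lambda>A. real (min (f i + of_bool (i \<in> A)) (s i)))"
      using frac_alloc[OF i] floor_le_alloc[OF i] \<gamma> by auto
  qed
  also have "\<dots> = measure_pmf.expectation p (\<lambda>A. \<Sum>i=1..K. real (min (f i + of_bool (i \<in> A)) (s i)))"
    by (rule Bochner_Integration.integral_sum[symmetric]) simp
  finally show ?thesis .
qed

end

section \<open>Expected change of the potential in one round\<close>

text \<open>For a comparator \<open>w\<close> this is the negated cross-entropy of the rows of
  \<open>x\<close> relative to those of \<open>w\<close>, summed over the units.\<close>

definition log_potential :: "nat \<Rightarrow> nat \<Rightarrow> weights \<Rightarrow> weights \<Rightarrow> real" where
  "log_potential K V w x = (\<Sum>v=1..V. \<Sum>i=1..K. w v i * ln (x v i))"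

text \<open>The round's regret is charged to the growth of the potential, scaled by
  \<open>1 / \<eta>\<close>. What remains is the second-moment term and the cost of mixing.\<close>

lemma (in sampled_round) potential_step:
  assumes n: "n \<le> V" and \<eta>: "0 < \<eta>" "\<eta> * (K / \<gamma>) \<le> 1" and w: "w \<in> comparators K V"
  shows "measure_pmf.expectation p (\<lambda>A.
      (\<Sum>i=1..K. min (\<Sum>v=1..n. w v i) (real (s i)) - real (min (f i + of_bool (i \<in> A)) (s i)))
        - log_potential K V w (update_weights K \<eta> \<gamma> n s A x) / \<eta>)
    \<le> - log_potential K V w x / \<eta> + (\<eta> * (V * K / \<gamma>) + \<gamma> * K)"
proof -
  let ?E = "measure_pmf.expectation p"
  let ?g = "\<lambda>A v i. grad_est K \<gamma> x n s A v i"
  let ?F = "\<Sum>i=1..K. min (\<Sum>v=1..n. w v i) (real (s i))"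
  let ?R = "\<lambda>A. \<Sum>i=1..K. real (min (f i + of_bool (i \<in> A)) (s i))"
  define L where "L A = (\<Sum>v=1..V. \<Sum>i=1..K. (w v i - x v i) * ?g A v i)" for A
  define Q where "Q A = (\<Sum>v=1..V. \<Sum>i=1..K. x v i * (?g A v i)\<^sup>2)" for A
  have "log_potential K V w x + \<eta> * L A - \<eta>\<^sup>2 * Q A
      \<le> log_potential K V w (update_weights K \<eta> \<gamma> n s A x)" for A
  proof -
    have "log_potential K V w x + \<eta> * L A - \<eta>\<^sup>2 * Q A
      = (\<Sum>v=1..V. (\<Sum>i=1..K. w v i * ln (x v i)) + \<eta> * (\<Sum>i=1..K. (w v i - x v i) * ?g A v i)
          - \<eta>\<^sup>2 * (\<Sum>i=1..K. x v i * (?g A v i)\<^sup>2))"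
      by (simp add: log_potential_def L_def Q_def sum.distrib sum_subtractf sum_distrib_left)
    also have "\<dots> \<le> log_potential K V w (update_weights K \<eta> \<gamma> n s A x)"
      unfolding log_potential_def update_weights_def
    proof (rule sum_mono, rule exponential_weights_step)
      fix v i assume v: "v \<in> {1..V}" 
      show "(\<Sum>i=1..K. w v i) = 1" using w v by (auto simp: comparators_def)
      assume i: "i \<in> {1..K}"
      have "\<eta> * ?g A v i \<le> \<eta> * (K / \<gamma>)"
        using \<eta> grad_est_le[OF i] by (intro mult_left_mono) auto
      then show "\<eta> * ?g A v i \<le> 1" using \<eta> by linarith
    qed (auto simp: x_pos x_sum)
    finally show ?thesis .
  qed
  then have path: "- log_potential K V w (update_weights K \<eta> \<gamma> n s A x) / \<eta>
      \<le> - log_potential K V w x / \<eta> - L A + \<eta> * Q A" for A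
    using \<eta> by (simp add: field_simps power2_eq_square)
  \<comment> \<open>All units within the volume share the expected slope \<open>supergrad i\<close>.
    The coordinate differences therefore add up to the difference of the total allocations, to which
    the supergradient inequality applies.\<close>
  have "?E L = (\<Sum>v=1..V. \<Sum>i=1..K. (w v i - x v i) * (of_bool (v \<le> n) * supergrad i))"
    by (simp add: L_def[abs_def] Bochner_Integration.integral_sum expectation_grad_est)
  also have "\<dots> = (\<Sum>i=1..K. \<Sum>v=1..V. of_bool (v \<le> n) * (supergrad i * (w v i - x v i)))"
    by (subst sum.swap) (simp add: mult_ac)
  also have "\<dots> = (\<Sum>i=1..K. \<Sum>v=1..n. supergrad i * (w v i - x v i))"
    using n by (intro sum.cong[OF refl] sum.mono_neutral_cong_right) auto
  also have "\<dots> = (\<Sum>i=1..K. supergrad i * ((\<Sum>v=1..n. w v i) - a i))"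
    by (simp add: alloc_def sum_subtractf flip: sum_distrib_left)
  also have "\<dots> \<ge> (\<Sum>i=1..K. min (\<Sum>v=1..n. w v i) (real (s i)) - min (a i) (real (s i)))"
    by (intro sum_mono) (simp add: diff_le_eq add.commute supergrad)
  finally have EL: "?F - (\<Sum>i=1..K. min (a i) (real (s i))) \<le> ?E L"
    by (simp add: sum_subtractf)
  have "?E Q = (\<Sum>v=1..V. \<Sum>i=1..K. x v i * ?E (\<lambda>A. (?g A v i)\<^sup>2))"
    by (simp add: Q_def[abs_def] Bochner_Integration.integral_sum)
  \<comment> \<open>The moment bound is uniform in the venue and each row of \<open>x\<close> sums
    to 1, so every unit contributes \<open>K / \<gamma>\<close>.\<close>
  also have "\<dots> \<le> (\<Sum>v=1..V. \<Sum>i=1..K. x v i * (K / \<gamma>))"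
    using x_pos by (intro sum_mono mult_left_mono expectation_grad_est_sq_le) (auto simp: less_imp_le)
  also have "\<dots> = V * K / \<gamma>"
    by (simp add: x_sum flip: sum_distrib_right sum_divide_distrib)
  finally have EQ: "\<eta> * ?E Q \<le> \<eta> * (V * K / \<gamma>)"
    using \<eta> by (intro mult_left_mono) auto
  have "?E (\<lambda>A. (\<Sum>i=1..K. min (\<Sum>v=1..n. w v i) (real (s i)) - real (min (f i + of_bool (i \<in> A)) (s i)))
        - log_potential K V w (update_weights K \<eta> \<gamma> n s A x) / \<eta>)
    \<le> ?E (\<lambda>A. ?F - ?R A + (- log_potential K V w x / \<eta> - L A + \<eta> * Q A))"
  proof (intro integral_mono integrable)
    show "(\<Sum>i=1..K. min (\<Sum>v=1..n. w v i) (real (s i)) - real (min (f i + of_bool (i \<in> A)) (s i)))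
        - log_potential K V w (update_weights K \<eta> \<gamma> n s A x) / \<eta>
      \<le> ?F - ?R A + (- log_potential K V w x / \<eta> - L A + \<eta> * Q A)" for A
      using path[of A] by (simp only: sum_subtractf)
  qed
  also have "\<dots> = ?F - ?E ?R + (- log_potential K V w x / \<eta> - ?E L + \<eta> * ?E Q)"
    by simp
  finally show ?thesis using EL EQ expectation_reward_ge by linarith
qed


section \<open>Weights and expectations along a run\<close>

lemma weights_at_pos:
  "i \<in> {1..K} \<Longrightarrow> 0 < weights_at K \<eta> \<gamma> vol lev \<omega> t v i"
proof (induction t arbitrary: v i)
  case (Suc t)
  have "0 < (\<Sum>j=1..K. weights_at K \<eta> \<gamma> vol lev \<omega> t v j
      * exp (\<eta> * grad_est K \<gamma> (weights_at K \<eta> \<gamma> vol lev \<omega> t) (vol t) (lev t) (\<omega> t) v j))"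
    using Suc by (intro sum_pos) auto
  then show ?case using Suc by (simp add: update_weights_def)
qed auto

lemma weights_at_sum:
  assumes "0 < K"
  shows "(\<Sum>i=1..K. weights_at K \<eta> \<gamma> vol lev \<omega> t v i) = 1"
proof (cases t)
  case 0
  then show ?thesis using assms by simp
next
  case (Suc r)
  have "0 < (\<Sum>j=1..K. weights_at K \<eta> \<gamma> vol lev \<omega> r v j
      * exp (\<eta> * grad_est K \<gamma> (weights_at K \<eta> \<gamma> vol lev \<omega> r) (vol r) (lev r) (\<omega> r) v j))"
    using assms by (intro sum_pos) (auto intro!: mult_pos_pos weights_at_pos)
  then show ?thesis by (simp add: Suc update_weights_def flip: sum_divide_distrib)
qed

text \<open>Round \<open>t\<close> only looks at earlier samples, so storing the set drawn in round
  \<open>t\<close> changes neither its weights nor earlier plays.\<close>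

lemma weights_at_cong:
  "(\<And>r. r < t \<Longrightarrow> \<omega> r = \<omega>' r)
    \<Longrightarrow> weights_at K \<eta> \<gamma> vol lev \<omega> t = weights_at K \<eta> \<gamma> vol lev \<omega>' t"
  by (induction t) auto

lemma play_fun_upd:
  "r < t \<Longrightarrow> play K \<eta> \<gamma> vol lev (fun_upd \<omega> t A) r = play K \<eta> \<gamma> vol lev \<omega> r"
  using weights_at_cong[of r "fun_upd \<omega> t A" \<omega>] by (intro ext) (simp add: play_def)

lemma finite_run:
  assumes "\<And>r \<omega>. r < t \<Longrightarrow> \<omega> \<in> set_pmf (run S r) \<Longrightarrow> finite (set_pmf (S r \<omega>))"
  shows "finite (set_pmf (run S t))"
  using assms by (induction t) auto

text \<open>Telescopes a bound on the conditional drift of \<open>h\<close>. The initial argument is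
  the constant empty sequence on which \<open>run S 0\<close> is concentrated; finite supports make
  every expectation a finite sum.\<close>

lemma expectation_run_le:
  fixes h :: "nat \<Rightarrow> (nat \<Rightarrow> nat set) \<Rightarrow> real"
  assumes fin: "\<And>r \<omega>. r < t \<Longrightarrow> \<omega> \<in> set_pmf (run S r) \<Longrightarrow> finite (set_pmf (S r \<omega>))"
    and step: "\<And>r \<omega>. r < t \<Longrightarrow> \<omega> \<in> set_pmf (run S r) \<Longrightarrow>
      measure_pmf.expectation (S r \<omega>) (\<lambda>A. h (Suc r) (fun_upd \<omega> r A)) \<le> h r \<omega> + c"
  shows "measure_pmf.expectation (run S t) (h t) \<le> h 0 (\<lambda>_. {}) + real t * c"
  using assms
proof (induction t)
  case (Suc t)
  let ?P = "set_pmf (run S t)"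
  have P: "finite ?P" using Suc.prems(1) by (intro finite_run) auto
  have "measure_pmf.expectation (run S (Suc t)) (h (Suc t))
    = (\<Sum>\<omega>\<in>?P. pmf (run S t) \<omega> * measure_pmf.expectation (S t \<omega>) (\<lambda>A. h (Suc t) (fun_upd \<omega> t A)))"
    using P Suc.prems(1) by (simp add: pmf_expectation_bind[of ?P])
  also have "\<dots> \<le> (\<Sum>\<omega>\<in>?P. pmf (run S t) \<omega> * (h t \<omega> + c))"
    by (intro sum_mono mult_left_mono Suc.prems(2)) simp_all
  also have "\<dots> = measure_pmf.expectation (run S t) (\<lambda>\<omega>. h t \<omega> + c)"
    using P by (subst integral_measure_pmf_real[of ?P]) (auto simp: mult.commute)
  also have "\<dots> = measure_pmf.expectation (run S t) (h t) + c"
    using P by (simp add: integrable_measure_pmf_finite)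
  also have "\<dots> \<le> h 0 (\<lambda>_. {}) + real t * c + c"
    using Suc by simp
  finally show ?case by (simp add: algebra_simps)
qed simp

section \<open>Regret bound for general parameters\<close>

lemma log_potential_nonpos:
  assumes "w \<in> comparators K V" "\<And>v i. i \<in> {1..K} \<Longrightarrow> 0 < x v i" "\<And>v. (\<Sum>i=1..K. x v i) = 1"
  shows "log_potential K V w x \<le> 0"
  unfolding log_potential_def
proof (intro sum_nonpos mult_nonneg_nonpos)
  fix v i assume v: "v \<in> {1..V}" and i: "i \<in> {1..K}"
  show "0 \<le> w v i" using assms(1) v i by (auto simp: comparators_def)
  have "x v i \<le> (\<Sum>i=1..K. x v i)"
    using assms(2) i by (intro member_le_sum) (auto simp: less_imp_le)
  then show "ln (x v i) \<le> 0" using assms(2)[OF i, of v] assms(3)[of v] by simp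
qed

lemma log_potential_uniform:
  assumes "w \<in> comparators K V"
  shows "log_potential K V w (\<lambda>v i. 1 / real K) = - real V * ln (real K)"
proof -
  have "log_potential K V w (\<lambda>v i. 1 / real K) = (\<Sum>v=1..V. (\<Sum>i=1..K. w v i) * ln (1 / real K))"
    by (simp only: log_potential_def sum_distrib_right)
  also have "\<dots> = (\<Sum>v=1..V. ln (1 / real K))"
    using assms by (intro sum.cong) (auto simp: comparators_def)
  finally show ?thesis by (simp add: ln_div)
qed

lemma expected_regret_le:
  assumes K: "0 < K" and \<gamma>: "0 < \<gamma>" "\<gamma> \<le> 1" and \<eta>: "0 < \<eta>" "\<eta> * (K / \<gamma>) \<le> 1"
    and vol: "\<forall>t<T. vol t \<le> V"
    and S: "valid_sampler K \<eta> \<gamma> vol lev T S"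
  shows "expected_regret K V T \<eta> \<gamma> vol lev S
    \<le> V * ln K / \<eta> + T * (\<eta> * (V * K / \<gamma>) + \<gamma> * K)"
proof -
  let ?B = "V * ln K / \<eta> + T * (\<eta> * (V * K / \<gamma>) + \<gamma> * K)"
  let ?E = "measure_pmf.expectation (run S T)"
  let ?x = "weights_at K \<eta> \<gamma> vol lev" and ?u = "play K \<eta> \<gamma> vol lev"
  define F where "F w t = (\<Sum>i=1..K. min (\<Sum>v=1..vol t. w v i) (real (lev t i)))" for w :: weights and t
  define R where "R \<omega> = (\<Sum>t<T. \<Sum>i=1..K. real (min (?u \<omega> t i) (lev t i)))" for \<omega>
  have round: "sampled_round K (vol t) \<gamma> (?x \<omega> t) (S t \<omega>)"
    if "t < T" "\<omega> \<in> set_pmf (run S t)" for t \<omega>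
    using that S K \<gamma> weights_at_pos weights_at_sum[OF K]
    by unfold_locales (auto simp: valid_sampler_def Let_def)
  have fin: "finite (set_pmf (S t \<omega>))" if "t < T" "\<omega> \<in> set_pmf (run S t)" for t \<omega>
  proof (rule finite_subset)
    show "set_pmf (S t \<omega>) \<subseteq> Pow {1..K}" using sampled_round.supp[OF round[OF that]] by auto
  qed simp
  have "finite (set_pmf (run S T))" using fin by (rule finite_run)
  then have [simp]: "integrable (run S T) h" for h :: "_ \<Rightarrow> real"
    by (rule integrable_measure_pmf_finite)
  \<comment> \<open>The right-hand side depends on neither \<open>w\<close> nor the sampled sets,
    which later allows a supremum over \<open>w\<close> for each \<open>\<omega>\<close>
    separately.\<close>
  have comp: "(\<Sum>t<T. F w t) \<le> ?E R + ?B" if w: "w \<in> comparators K V" for w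
  proof -
    \<comment> \<open>The regret against \<open>w\<close> so far minus the scaled potential;
      \<open>potential_step\<close> bounds its drift.\<close>
    define h where "h t \<omega> = (\<Sum>r<t. \<Sum>i=1..K. min (\<Sum>v=1..vol r. w v i) (real (lev r i)) - real (min (?u \<omega> r i) (lev r i)))
        - log_potential K V w (?x \<omega> t) / \<eta>" for t \<omega>
    have "?E (h T) \<le> h 0 (\<lambda>_. {}) + T * (\<eta> * (V * K / \<gamma>) + \<gamma> * K)"
    proof (rule expectation_run_le[OF fin])
      fix t \<omega> assume t: "t < T" "\<omega> \<in> set_pmf (run S t)"
      interpret sampled_round K "vol t" \<gamma> "?x \<omega> t" "lev t" "S t \<omega>" by (rule round[OF t])
      let ?D = "\<Sum>r<t. \<Sum>i=1..K. min (\<Sum>v=1..vol r. w v i) (real (lev r i)) - real (min (?u \<omega> r i) (lev r i))"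
      let ?h = "\<lambda>A. (\<Sum>i=1..K. min (\<Sum>v=1..vol t. w v i) (real (lev t i)) - real (min (f i + of_bool (i \<in> A)) (lev t i)))
        - log_potential K V w (update_weights K \<eta> \<gamma> (vol t) (lev t) A (?x \<omega> t)) / \<eta>"
      have x: "?x (fun_upd \<omega> t A) t = ?x \<omega> t" for A by (rule weights_at_cong) simp
      have "h (Suc t) (fun_upd \<omega> t A) = ?D + ?h A" for A
        by (simp add: h_def play_fun_upd x) (simp add: play_def x)
      then have "measure_pmf.expectation (S t \<omega>) (\<lambda>A. h (Suc t) (fun_upd \<omega> t A))
        = measure_pmf.expectation (S t \<omega>) (\<lambda>A. ?D + ?h A)" by simp
      also have "\<dots> = ?D + measure_pmf.expectation (S t \<omega>) ?h"
        by (subst Bochner_Integration.integral_add) (simp_all add: integrable)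
      also have "\<dots> \<le> h t \<omega> + (\<eta> * (V * K / \<gamma>) + \<gamma> * K)"
        using potential_step[OF _ \<eta> w] vol t by (simp add: h_def)
      finally show "measure_pmf.expectation (S t \<omega>) (\<lambda>A. h (Suc t) (fun_upd \<omega> t A))
        \<le> h t \<omega> + (\<eta> * (V * K / \<gamma>) + \<gamma> * K)" .
    qed
    also have "h 0 (\<lambda>_. {}) = V * ln K / \<eta>"
      by (simp add: h_def log_potential_uniform[OF w])
    finally have "?E (h T) \<le> ?B" .
    moreover have "(\<Sum>t<T. F w t) - ?E R = ?E (\<lambda>\<omega>. (\<Sum>t<T. F w t) - R \<omega>)"
      by simp
    moreover have "\<dots> \<le> ?E (h T)"
    proof (intro integral_mono)
      fix \<omega>
      \<comment> \<open>The final potential enters \<open>h T\<close> with a minus sign, so dropping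
        it only decreases the value.\<close>
      have "log_potential K V w (?x \<omega> T) / \<eta> \<le> 0"
        using log_potential_nonpos[OF w weights_at_pos weights_at_sum[OF K]] \<eta>
        by (simp add: divide_nonpos_pos)
      then show "(\<Sum>t<T. F w t) - R \<omega> \<le> h T \<omega>"
        by (simp add: h_def F_def R_def sum_subtractf)
    qed simp_all
    ultimately show ?thesis by linarith
  qed
  have "(\<lambda>v i. 1 / real K) \<in> comparators K V" using K by (simp add: comparators_def)
  then have ne: "comparators K V \<noteq> {}" by blast
  \<comment> \<open>In expectation \<open>R \<omega>\<close> cancels against its mean, leaving
    \<open>?B\<close>.\<close>
  have "regret K V T vol lev (?u \<omega>) \<le> ?E R + ?B - R \<omega>" for \<omega>
    unfolding regret_def
  proof (rule cSUP_least[OF ne])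
    fix w assume "w \<in> comparators K V"
    from comp[OF this] show "(\<Sum>t<T. \<Sum>i=1..K. min (\<Sum>v=1..vol t. w v i) (real (lev t i))
        - real (min (?u \<omega> t i) (lev t i))) \<le> ?E R + ?B - R \<omega>"
      by (simp add: F_def R_def sum_subtractf)
  qed
  then have "expected_regret K V T \<eta> \<gamma> vol lev S \<le> ?E (\<lambda>\<omega>. ?E R + ?B - R \<omega>)"
    unfolding expected_regret_def by (intro integral_mono) simp_all
  then show ?thesis by simp
qed

section \<open>Choice of the parameters\<close>

lemma cube_powr:
  fixes y p :: real
  assumes "0 < y"
  shows "(y ^ 3) powr p = y powr (3 * p)"
  using powr_realpow[OF assms, of 3] powr_powr[of y 3 p] by simp

text \<open>Writing \<open>K\<close>, \<open>V\<close>, \<open>T\<close> and \<open>ln K\<close> as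
  cubes turns all fractional powers into monomials.\<close>

lemma cube_root_pos:
  fixes z :: real
  assumes "0 < z"
  obtains y where "0 < y" "z = y ^ 3"
  using assms that[of "root 3 z"] by (simp add: real_root_pow_pos)

theorem theorem3:
  "\<exists>C::real. C > 0 \<and>
     (\<forall>K\<ge>2. \<forall>V\<ge>1. \<exists>T0. \<forall>T\<ge>T0. \<exists>\<gamma>. 0 < \<gamma> \<and> \<gamma> \<le> 1 \<and>
        (\<forall>(vol :: nat \<Rightarrow> nat) (lev :: nat \<Rightarrow> nat \<Rightarrow> nat) (S :: sampler).
           (\<forall>t<T. 1 \<le> vol t \<and> vol t \<le> V) \<longrightarrow>
           valid_sampler K (learning_rate K V T) \<gamma> vol lev T S \<longrightarrow>
           expected_regret K V T (learning_rate K V T) \<gamma> vol lev S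
             \<le> C * (real V * real T * real K) powr (2 / 3) * (ln (real K)) powr (1 / 3)))"
proof (intro exI[of _ "3::real"] conjI allI impI)
  fix K V :: nat assume K: "2 \<le> K" and V: "1 \<le> V"
  show "\<exists>T0. \<forall>T\<ge>T0. \<exists>\<gamma>. 0 < \<gamma> \<and> \<gamma> \<le> 1 \<and>
        (\<forall>(vol :: nat \<Rightarrow> nat) (lev :: nat \<Rightarrow> nat \<Rightarrow> nat) (S :: sampler).
           (\<forall>t<T. 1 \<le> vol t \<and> vol t \<le> V) \<longrightarrow>
           valid_sampler K (learning_rate K V T) \<gamma> vol lev T S \<longrightarrow>
           expected_regret K V T (learning_rate K V T) \<gamma> vol lev S
             \<le> 3 * (real V * real T * real K) powr (2 / 3) * (ln (real K)) powr (1 / 3))"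
  \<comment> \<open>The summand \<open>V\<^sup>2\<close> secures \<open>\<gamma> \<le> 1\<close>,
    and \<open>K ^ 3\<close> secures the exponent condition on the learning rate.\<close>
  proof (intro exI[of _ "K ^ 3 + V\<^sup>2"] allI impI)
    fix T assume T: "K ^ 3 + V\<^sup>2 \<le> T"
    have "0 < T" using T V by (intro gr0I) auto
    obtain k where k: "0 < k" "real K = k ^ 3" using cube_root_pos[of "real K"] K by auto
    obtain a where a: "0 < a" "real V = a ^ 3" using cube_root_pos[of "real V"] V by auto
    obtain t where t: "0 < t" "real T = t ^ 3" using cube_root_pos[of "real T"] \<open>0 < T\<close> by auto
    obtain l where l: "0 < l" "ln (real K) = l ^ 3" using cube_root_pos[of "ln (real K)"] K by auto
    \<comment> \<open>This \<open>\<gamma>\<close> makes all three terms of the regret bound equal.\<close>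
    define \<gamma> where "\<gamma> = a\<^sup>2 * l / (k * t)"
    have \<eta>: "learning_rate K V T = a * l\<^sup>2 / (k\<^sup>2 * t\<^sup>2)"
    proof -
      have "real V * (ln (real K))\<^sup>2 / ((real K)\<^sup>2 * (real T)\<^sup>2) = (a * l\<^sup>2 / (k\<^sup>2 * t\<^sup>2)) ^ 3"
        unfolding l(2) unfolding k(2) a(2) t(2)
        by (simp add: power_divide power_mult_distrib flip: power_mult)
      then show ?thesis
        unfolding learning_rate_def using k(1) a(1) t(1) l(1) by (simp add: cube_powr)
    qed
    have bound: "(real V * real T * real K) powr (2 / 3) = (a * t * k)\<^sup>2"
    proof -
      have "real V * real T * real K = (a * t * k) ^ 3"
        by (simp add: k a t power_mult_distrib)
      then show ?thesis using k a t by (simp add: cube_powr)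
    qed
    have bound': "ln (real K) powr (1 / 3) = l"
      using l by (simp add: cube_powr)
    have lnK: "ln (real K) \<le> real K" using ln_le_minus_one[of "real K"] K by simp
    \<comment> \<open>The inequality \<open>\<gamma> \<le> 1\<close> is proved in cubed
      form.\<close>
    have "(a\<^sup>2 * l) ^ 3 = (real V)\<^sup>2 * ln (real K)"
      by (simp add: a l(2) power_mult_distrib flip: power_mult)
    also have "\<dots> \<le> real T * real K"
    proof (rule mult_mono)
      show "(real V)\<^sup>2 \<le> real T" using T by (simp flip: of_nat_power)
    qed (use lnK K in auto)
    also have "\<dots> = (k * t) ^ 3" by (simp add: k t power_mult_distrib)
    finally have "a\<^sup>2 * l \<le> k * t" using k a t l by (simp add: power_mono_iff)
    then have \<gamma>1: "\<gamma> \<le> 1" using k t by (simp add: \<gamma>_def)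
    \<comment> \<open>The exponent condition amounts to \<open>l * k\<^sup>2 \<le> a * t\<close>,
      again proved in cubed form.\<close>
    have "(l * k\<^sup>2) ^ 3 = ln (real K) * (real K)\<^sup>2"
      by (simp add: k l(2)[unfolded k] power_mult_distrib flip: power_mult)
    also have "\<dots> \<le> real K * (real K)\<^sup>2" using lnK by (intro mult_right_mono) auto
    also have "\<dots> = real (K ^ 3)" by (simp add: power2_eq_square power3_eq_cube)
    also have "\<dots> \<le> real T" using T by (simp only: of_nat_le_iff)
    also have "\<dots> \<le> real V * real T" using mult_right_mono[of 1 "real V" "real T"] V by simp
    also have "\<dots> = (a * t) ^ 3" by (simp add: a t power_mult_distrib)
    finally have "l * k\<^sup>2 \<le> a * t" using k a t l by (simp add: power_mono_iff)
    moreover have "learning_rate K V T * (K / \<gamma>) = l * k\<^sup>2 / (a * t)"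
      unfolding \<eta> \<gamma>_def k(2) using k(1) a(1) t(1) l(1) by (simp add: divide_simps) algebra
    ultimately have \<eta>1: "learning_rate K V T * (K / \<gamma>) \<le> 1" using a t by simp
    have "V * ln K / learning_rate K V T = (a * t * k)\<^sup>2 * l"
      unfolding \<eta> l(2) a(2) using k(1) a(1) t(1) l(1) by (simp add: divide_simps) algebra
    moreover have "T * (learning_rate K V T * (real V * real K / \<gamma>)) = (a * t * k)\<^sup>2 * l"
      unfolding \<eta> \<gamma>_def k(2) a(2) t(2) using k(1) a(1) t(1) l(1) by (simp add: divide_simps) algebra
    moreover have "T * (\<gamma> * K) = (a * t * k)\<^sup>2 * l"
      unfolding \<gamma>_def k(2) t(2) using k(1) a(1) t(1) l(1) by (simp add: divide_simps) algebra
    \<comment> \<open>Three equal terms account for the constant 3.\<close>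
    ultimately have total: "V * ln K / learning_rate K V T
        + T * (learning_rate K V T * (real V * real K / \<gamma>) + \<gamma> * K) = 3 * (a * t * k)\<^sup>2 * l"
      by (simp add: distrib_left)
    show "\<exists>\<gamma>. 0 < \<gamma> \<and> \<gamma> \<le> 1 \<and>
        (\<forall>(vol :: nat \<Rightarrow> nat) (lev :: nat \<Rightarrow> nat \<Rightarrow> nat) (S :: sampler).
           (\<forall>t<T. 1 \<le> vol t \<and> vol t \<le> V) \<longrightarrow>
           valid_sampler K (learning_rate K V T) \<gamma> vol lev T S \<longrightarrow>
           expected_regret K V T (learning_rate K V T) \<gamma> vol lev S
             \<le> 3 * (real V * real T * real K) powr (2 / 3) * (ln (real K)) powr (1 / 3))"
    proof (intro exI[of _ \<gamma>] conjI allI impI)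
      show \<gamma>0: "0 < \<gamma>" using k a t l by (simp add: \<gamma>_def)
      fix vol lev S
      assume vol: "\<forall>t<T. 1 \<le> vol t \<and> vol t \<le> V"
        and S: "valid_sampler K (learning_rate K V T) \<gamma> vol lev T S"
      have "expected_regret K V T (learning_rate K V T) \<gamma> vol lev S
        \<le> V * ln K / learning_rate K V T + T * (learning_rate K V T * (real V * real K / \<gamma>) + \<gamma> * K)"
      proof (rule expected_regret_le[OF _ \<gamma>0 \<gamma>1 _ \<eta>1 _ S])
        show "0 < learning_rate K V T" using k a t l by (simp add: \<eta>)
      qed (use K vol in auto)
      then show "expected_regret K V T (learning_rate K V T) \<gamma> vol lev S
        \<le> 3 * (real V * real T * real K) powr (2 / 3) * (ln (real K)) powr (1 / 3)"
        unfolding bound bound' total .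
    qed (rule \<gamma>1)
  qed
qed simp

end
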